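(* Let $\mathbb{T}$ be the unit circle with normalized Lebesgue measure, $L^\infty=L^\infty(\mathbb{T})$ and $L^2=L^2(\mathbb{T})$ (complex-valued). For $g\in L^\infty$ let $M_g:L^2\to L^2$ be the multiplication operator $M_g(f)=g\cdot f$. Let $\varphi:L^\infty\times L^\infty\to L(L^2)$ be the bounded $L(L^2)$-valued inner product defined by $\varphi(f,g)=M_{f\overline{g}}$. Then $L^\infty$ is a Hilbert space with respect to $\varphi$.
   Context: For a nonzero complex Hilbert space $H$, $L(H)$ denotes the bounded linear operators on $H$ with the operator norm, $I_H$ is the identity operator, and $S\le T$ means that $T-S$ is positive, where an operator $P$ is positive if $(Ph,h)\ge 0$ for all $h\in H$. An $L(H)$-valued norm on a complex linear space $X$ is a function $F:X\to L(H)$ such that (1) $F(x)\ge 0$ for all $x$; (2) $F(x+y)\le F(x)+F(y)$ for all $x,y$; (3) $F(\lambda x)=|\lambda|F(x)$ for all $\lambda\in\mathbb{C}$, $x\in X$; (4) $F(x)=0$ if and only if $x=0$. A sequence $\{x_n\}$ is Cauchy with respect to $F$ if for every $\epsilon>0$ there is $N$ with $F(x_n-x_m)\le\epsilon I_H$ for all $n,m\ge N$; it converges to $x\in X$ with respect to $F$ if for every $\epsilon>0$ there is $N$ with $F(x_n-x)\le\epsilon I_H$ for all $n\ge N$. $X$ is complete with respect to $F$ if every sequence that is Cauchy with respect to $F$ converges with respect to $F$ to an element of $X$. A conjugate-bilinear map is one that is additive in each variable, linear in one of the two variables and conjugate-linear in the other. An $L(H)$-valued inner product on $X$ is a conjugate-bilinear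 map $\varphi:X\times X\to L(H)$ such that (1) $\varphi(x,x)\ge 0$ for all $x$; (2) $\varphi(x,x)=0$ if and only if $x=0$; (3) $\varphi(x,y)=\varphi(y,x)^*$ for all $x,y$. Put $F_\varphi(x)=[\varphi(x,x)]^{1/2}$ (positive square root). When $F_\varphi$ is an $L(H)$-valued norm, $\varphi$ is called bounded if there is $M>0$ with $\|\varphi(x,y)\|\le M\|F_\varphi(x)\|\,\|F_\varphi(y)\|$ for all $x,y\in X$. $X$ is a Hilbert space with respect to $\varphi$ if $\varphi$ is an $L(H)$-valued inner product on $X$, $F_\varphi$ is an $L(H)$-valued norm on $X$, and $X$ is complete with respect to $F_\varphi$. *)

theory Defs
  imports "HOL-Analysis.Analysis" "HOL-Library.Nonpos_Ints"
begin

section \<open>Complex linear spaces and complex Hilbert spaces\<close>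

class complex_vector = ab_group_add +
  fixes scaleC :: "complex \<Rightarrow> 'a \<Rightarrow> 'a"  (infixr "*\<^sub>C" 75)
  assumes scaleC_add_right: "a *\<^sub>C (x + y) = a *\<^sub>C x + a *\<^sub>C y"
    and scaleC_add_left: "(a + b) *\<^sub>C x = a *\<^sub>C x + b *\<^sub>C x"
    and scaleC_scaleC: "a *\<^sub>C (b *\<^sub>C x) = (a * b) *\<^sub>C x"
    and scaleC_one: "1 *\<^sub>C x = x"

text \<open>The inner product is linear in its first argument.\<close>

class complex_inner = complex_vector + real_normed_vector +
  fixes cinner :: "'a \<Rightarrow> 'a \<Rightarrow> complex"
  assumes scaleR_scaleC: "r *\<^sub>R x = complex_of_real r *\<^sub>C x"
    and cinner_commute: "cinner x y = cnj (cinner y x)"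
    and cinner_add_left: "cinner (x + y) z = cinner x z + cinner y z"
    and cinner_scaleC_left: "cinner (c *\<^sub>C x) y = c * cinner x y"
    and cinner_nonneg: "cinner x x \<in> \<real>\<^sub>\<ge>\<^sub>0"
    and cinner_eq_zero_iff: "cinner x x = 0 \<longleftrightarrow> x = 0"
    and norm_eq_sqrt_cinner: "norm x = sqrt (Re (cinner x x))"

class complex_hilbert = complex_inner + complete_space +
  assumes not_trivial: "\<exists>x. x \<noteq> 0"


section \<open>Bounded operators on a complex Hilbert space\<close>

typedef (overloaded) 'h bop =
  "{T :: 'h::complex_hilbert \<Rightarrow> 'h. bounded_linear T \<and> (\<forall>c x. T (c *\<^sub>C x) = c *\<^sub>C T x)}"
  morphisms bop_apply Bop
proof
  show "(\<lambda>x. x) \<in> {T :: 'h \<Rightarrow> 'h. bounded_linear T \<and> (\<forall>c x. T (c *\<^sub>C x) = c *\<^sub>C T x)}"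
    by (simp add: bounded_linear_ident)
qed

setup_lifting type_definition_bop

lemma scaleC_zero_right: "c *\<^sub>C (0::'a::complex_vector) = 0"
  using scaleC_add_right[of c 0 0] by simp

lemma scaleC_minus_right: "c *\<^sub>C (- x) = - (c *\<^sub>C (x::'a::complex_vector))"
  using scaleC_add_right[of c "x" "- x"] by (simp add: scaleC_zero_right eq_neg_iff_add_eq_0 add.commute)

lemma scaleC_diff_right: "c *\<^sub>C (x - y) = c *\<^sub>C x - c *\<^sub>C (y::'a::complex_vector)"
  using scaleC_add_right[of c "x" "- y"] by (simp add: scaleC_minus_right)

lemma norm_scaleC: "norm (c *\<^sub>C (x::'a::complex_inner)) = cmod c * norm x"
proof -
  have "cinner (c *\<^sub>C x) (c *\<^sub>C x) = c * cinner x (c *\<^sub>C x)"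
    by (rule cinner_scaleC_left)
  also have "cinner x (c *\<^sub>C x) = cnj (c * cinner x x)"
    by (subst cinner_commute) (simp add: cinner_scaleC_left)
  also have "\<dots> = cnj c * cinner x x"
    using cinner_commute[of x x] by simp
  finally have "cinner (c *\<^sub>C x) (c *\<^sub>C x) = (c * cnj c) * cinner x x"
    by simp
  also have "c * cnj c = complex_of_real ((cmod c)\<^sup>2)"
    by (simp add: complex_norm_square del: of_real_power)
  finally have "Re (cinner (c *\<^sub>C x) (c *\<^sub>C x)) = (cmod c)\<^sup>2 * Re (cinner x x)"
    by simp
  then show ?thesis
    by (simp add: norm_eq_sqrt_cinner real_sqrt_mult)
qed

lemma bounded_linear_scaleC: "bounded_linear (\<lambda>x::'a::complex_inner. c *\<^sub>C x)"
proof (rule bounded_linear_intro)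
  fix x y :: 'a and r :: real
  show "c *\<^sub>C (x + y) = c *\<^sub>C x + c *\<^sub>C y" by (rule scaleC_add_right)
  show "c *\<^sub>C (r *\<^sub>R x) = r *\<^sub>R (c *\<^sub>C x)"
    by (simp add: scaleR_scaleC scaleC_scaleC mult.commute)
  show "norm (c *\<^sub>C x) \<le> norm x * cmod c"
    by (simp add: norm_scaleC)
qed

instantiation bop :: (complex_hilbert) complex_vector
begin

lift_definition zero_bop :: "'a bop" is "\<lambda>x. 0"
  by (simp add: scaleC_zero_right)

lift_definition plus_bop :: "'a bop \<Rightarrow> 'a bop \<Rightarrow> 'a bop" is "\<lambda>S T x. S x + T x"
  by (simp add: bounded_linear_add scaleC_add_right)

lift_definition uminus_bop :: "'a bop \<Rightarrow> 'a bop" is "\<lambda>T x. - T x"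
  by (simp add: bounded_linear_minus scaleC_minus_right)

lift_definition minus_bop :: "'a bop \<Rightarrow> 'a bop \<Rightarrow> 'a bop" is "\<lambda>S T x. S x - T x"
  by (simp add: bounded_linear_sub scaleC_diff_right)

lift_definition scaleC_bop :: "complex \<Rightarrow> 'a bop \<Rightarrow> 'a bop" is "\<lambda>c T x. c *\<^sub>C T x"
  using bounded_linear_compose[OF bounded_linear_scaleC]
  by (auto simp: scaleC_scaleC mult.commute)

instance
  by standard
    (transfer; force simp: fun_eq_iff scaleC_add_right scaleC_add_left scaleC_scaleC scaleC_one)+

end

lift_definition bop_id :: "'h::complex_hilbert bop" is "\<lambda>x. x"
  by (simp add: bounded_linear_ident)

lift_definition bop_comp :: "'h::complex_hilbert bop \<Rightarrow> 'h bop \<Rightarrow> 'h bop" is "\<lambda>S T x. S (T x)"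
  by (simp add: bounded_linear_compose)

lift_definition bop_norm :: "'h::complex_hilbert bop \<Rightarrow> real" is onorm .

text \<open>
  On a Hilbert space every bounded operator has exactly one adjoint, and every positive operator
  exactly one positive square root, so the definite descriptions below always denote.
\<close>

definition bop_adj :: "'h::complex_hilbert bop \<Rightarrow> 'h bop" where
  "bop_adj T = (THE S. \<forall>x y. cinner (bop_apply T x) y = cinner x (bop_apply S y))"

definition positive_op :: "'h::complex_hilbert bop \<Rightarrow> bool" where
  "positive_op P \<longleftrightarrow> (\<forall>h. cinner (bop_apply P h) h \<in> \<real>\<^sub>\<ge>\<^sub>0)"

definition op_le :: "'h::complex_hilbert bop \<Rightarrow> 'h bop \<Rightarrow> bool"  (infix "\<sqsubseteq>" 50) where
  "S \<sqsubseteq> T \<longleftrightarrow> positive_op (T - S)"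

definition op_sqrt :: "'h::complex_hilbert bop \<Rightarrow> 'h bop" where
  "op_sqrt P = (THE S. positive_op S \<and> bop_comp S S = P)"


section \<open>Operator-valued norms and inner products\<close>

definition op_valued_norm :: "('x::complex_vector \<Rightarrow> 'h::complex_hilbert bop) \<Rightarrow> bool" where
  "op_valued_norm F \<longleftrightarrow>
     (\<forall>x. 0 \<sqsubseteq> F x) \<and>
     (\<forall>x y. F (x + y) \<sqsubseteq> F x + F y) \<and>
     (\<forall>c x. F (c *\<^sub>C x) = complex_of_real (cmod c) *\<^sub>C F x) \<and>
     (\<forall>x. F x = 0 \<longleftrightarrow> x = 0)"

definition op_Cauchy :: "('x::complex_vector \<Rightarrow> 'h::complex_hilbert bop) \<Rightarrow> (nat \<Rightarrow> 'x) \<Rightarrow> bool" where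
  "op_Cauchy F u \<longleftrightarrow>
     (\<forall>e>0. \<exists>N. \<forall>n\<ge>N. \<forall>m\<ge>N. F (u n - u m) \<sqsubseteq> complex_of_real e *\<^sub>C bop_id)"

definition op_converges ::
  "('x::complex_vector \<Rightarrow> 'h::complex_hilbert bop) \<Rightarrow> (nat \<Rightarrow> 'x) \<Rightarrow> 'x \<Rightarrow> bool" where
  "op_converges F u x \<longleftrightarrow>
     (\<forall>e>0. \<exists>N. \<forall>n\<ge>N. F (u n - x) \<sqsubseteq> complex_of_real e *\<^sub>C bop_id)"

definition op_complete :: "('x::complex_vector \<Rightarrow> 'h::complex_hilbert bop) \<Rightarrow> bool" where
  "op_complete F \<longleftrightarrow> (\<forall>u. op_Cauchy F u \<longrightarrow> (\<exists>x. op_converges F u x))"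

text \<open>
  Which of the two variables is the linear one is left open.
\<close>

definition conjugate_bilinear ::
  "('x::complex_vector \<Rightarrow> 'x \<Rightarrow> 'y::complex_vector) \<Rightarrow> bool" where
  "conjugate_bilinear \<phi> \<longleftrightarrow>
     (\<forall>x x' y. \<phi> (x + x') y = \<phi> x y + \<phi> x' y) \<and>
     (\<forall>x y y'. \<phi> x (y + y') = \<phi> x y + \<phi> x y') \<and>
     ((\<forall>c x y. \<phi> (c *\<^sub>C x) y = c *\<^sub>C \<phi> x y \<and> \<phi> x (c *\<^sub>C y) = cnj c *\<^sub>C \<phi> x y) \<or>
      (\<forall>c x y. \<phi> (c *\<^sub>C x) y = cnj c *\<^sub>C \<phi> x y \<and> \<phi> x (c *\<^sub>C y) = c *\<^sub>C \<phi> x y))"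

definition op_inner_product ::
  "('x::complex_vector \<Rightarrow> 'x \<Rightarrow> 'h::complex_hilbert bop) \<Rightarrow> bool" where
  "op_inner_product \<phi> \<longleftrightarrow>
     conjugate_bilinear \<phi> \<and>
     (\<forall>x. 0 \<sqsubseteq> \<phi> x x) \<and>
     (\<forall>x. \<phi> x x = 0 \<longleftrightarrow> x = 0) \<and>
     (\<forall>x y. \<phi> x y = bop_adj (\<phi> y x))"

definition induced_norm ::
  "('x::complex_vector \<Rightarrow> 'x \<Rightarrow> 'h::complex_hilbert bop) \<Rightarrow> 'x \<Rightarrow> 'h bop" where
  "induced_norm \<phi> x = op_sqrt (\<phi> x x)"

definition bounded_op_inner_product ::
  "('x::complex_vector \<Rightarrow> 'x \<Rightarrow> 'h::complex_hilbert bop) \<Rightarrow> bool" where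
  "bounded_op_inner_product \<phi> \<longleftrightarrow>
     op_inner_product \<phi> \<and> op_valued_norm (induced_norm \<phi>) \<and>
     (\<exists>M>0. \<forall>x y. bop_norm (\<phi> x y) \<le>
        M * bop_norm (induced_norm \<phi> x) * bop_norm (induced_norm \<phi> y))"

definition Hilbert_space_wrt ::
  "('x::complex_vector \<Rightarrow> 'x \<Rightarrow> 'h::complex_hilbert bop) \<Rightarrow> bool" where
  "Hilbert_space_wrt \<phi> \<longleftrightarrow>
     op_inner_product \<phi> \<and> op_valued_norm (induced_norm \<phi>) \<and> op_complete (induced_norm \<phi>)"


section \<open>The unit circle\<close>

text \<open>
  Normalized arc length, as the image of the uniform distribution on \<open>[0, 2\<pi>]\<close> under
  \<open>t \<mapsto> exp (i t)\<close>.  The measure lives on the Borel sets of the circle; since functions are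
  identified almost everywhere below, passing to the completion would give the same spaces.
\<close>

definition circle :: "complex measure" where
  "circle = distr (uniform_measure lborel {0..2 * pi}) (restrict_space borel (sphere 0 1)) cis"

lemma space_circle: "space circle = sphere 0 1"
  by (simp add: circle_def space_restrict_space)

lemma measurable_cis_circle:
  "cis \<in> uniform_measure lborel {0..2 * pi} \<rightarrow>\<^sub>M restrict_space borel (sphere 0 1)"
proof (rule measurable_restrict_space2)
  have "continuous_on UNIV cis" by (rule continuous_on_cis[OF continuous_on_id])
  then show "cis \<in> uniform_measure lborel {0..2 * pi} \<rightarrow>\<^sub>M borel"
    using borel_measurable_continuous_onI by (simp add: measurable_def uniform_measure_def)
qed auto

lemma emeasure_circle: "emeasure circle (space circle) = 1"
  unfolding circle_def
  by (subst emeasure_distr[OF measurable_cis_circle])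
     (auto simp: space_restrict_space sets_restrict_space vimage_def)

lemma finite_measure_circle: "finite_measure circle"
  by (rule finite_measureI) (simp add: emeasure_circle)

interpretation circle: finite_measure circle
  by (rule finite_measure_circle)


section \<open>The space of essentially bounded functions on the circle\<close>

definition Linf_fun :: "(complex \<Rightarrow> complex) \<Rightarrow> bool" where
  "Linf_fun f \<longleftrightarrow> f \<in> borel_measurable circle \<and> (\<exists>C. AE z in circle. cmod (f z) \<le> C)"

definition L2_fun :: "(complex \<Rightarrow> complex) \<Rightarrow> bool" where
  "L2_fun f \<longleftrightarrow> f \<in> borel_measurable circle \<and> integrable circle (\<lambda>z. (cmod (f z))\<^sup>2)"

lemma measurable_cnj_circle [measurable (raw)]:
  "f \<in> borel_measurable M \<Longrightarrow> (\<lambda>z. cnj (f z)) \<in> borel_measurable M"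
  by (rule borel_measurable_continuous_on[OF continuous_on_cnj[OF continuous_on_id]])

lemma Linf_fun_add: "Linf_fun f \<Longrightarrow> Linf_fun g \<Longrightarrow> Linf_fun (\<lambda>z. f z + g z)"
proof -
  assume f: "Linf_fun f" and g: "Linf_fun g"
  then obtain C D where "AE z in circle. cmod (f z) \<le> C" "AE z in circle. cmod (g z) \<le> D"
    unfolding Linf_fun_def by auto
  then have "AE z in circle. cmod (f z + g z) \<le> C + D"
    by eventually_elim (rule norm_triangle_mono)
  then show ?thesis using f g unfolding Linf_fun_def by auto
qed

lemma Linf_fun_mult: "Linf_fun f \<Longrightarrow> Linf_fun g \<Longrightarrow> Linf_fun (\<lambda>z. f z * g z)"
proof -
  assume f: "Linf_fun f" and g: "Linf_fun g"
  then obtain C D where "AE z in circle. cmod (f z) \<le> C" "AE z in circle. cmod (g z) \<le> D"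
    unfolding Linf_fun_def by auto
  then have "AE z in circle. cmod (f z * g z) \<le> C * D"
    by eventually_elim (simp add: norm_mult mult_mono' )
  then show ?thesis using f g unfolding Linf_fun_def by auto
qed

lemma Linf_fun_const: "Linf_fun (\<lambda>z. c)"
  unfolding Linf_fun_def by auto

lemma Linf_fun_cnj: "Linf_fun f \<Longrightarrow> Linf_fun (\<lambda>z. cnj (f z))"
  unfolding Linf_fun_def by auto

lemma Linf_fun_scale: "Linf_fun f \<Longrightarrow> Linf_fun (\<lambda>z. c * f z)"
  by (rule Linf_fun_mult[OF Linf_fun_const])

lemma Linf_fun_uminus: "Linf_fun f \<Longrightarrow> Linf_fun (\<lambda>z. - f z)"
  using Linf_fun_scale[of f "-1"] by simp

lemma Linf_fun_diff: "Linf_fun f \<Longrightarrow> Linf_fun g \<Longrightarrow> Linf_fun (\<lambda>z. f z - g z)"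
  using Linf_fun_add[OF _ Linf_fun_uminus, of f g] by simp

lemma L2_fun_scale: "L2_fun f \<Longrightarrow> L2_fun (\<lambda>z. c * f z)"
  unfolding L2_fun_def by (auto simp: norm_mult power_mult_distrib)

lemma L2_fun_zero: "L2_fun (\<lambda>z. 0)"
  unfolding L2_fun_def by auto

lemma L2_fun_one: "L2_fun (\<lambda>z. 1)"
  unfolding L2_fun_def by auto

lemma L2_fun_prod_integrable:
  assumes "L2_fun f" "L2_fun g"
  shows "integrable circle (\<lambda>z. f z * cnj (g z))"
proof (rule Bochner_Integration.integrable_bound)
  show "integrable circle (\<lambda>z. (cmod (f z))\<^sup>2 + (cmod (g z))\<^sup>2)"
    using assms unfolding L2_fun_def by auto
  show "(\<lambda>z. f z * cnj (g z)) \<in> borel_measurable circle"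
    using assms unfolding L2_fun_def by auto
  show "AE z in circle. norm (f z * cnj (g z)) \<le> norm ((cmod (f z))\<^sup>2 + (cmod (g z))\<^sup>2)"
  proof (rule AE_I2)
    fix z
    have "2 * (cmod (f z) * cmod (g z)) \<le> (cmod (f z))\<^sup>2 + (cmod (g z))\<^sup>2"
      using sum_squares_bound[of "cmod (f z)" "cmod (g z)"] by simp
    then have "cmod (f z) * cmod (g z) \<le> (cmod (f z))\<^sup>2 + (cmod (g z))\<^sup>2"
      using mult_nonneg_nonneg[OF norm_ge_zero[of "f z"] norm_ge_zero[of "g z"]] by linarith
    then show "norm (f z * cnj (g z)) \<le> norm ((cmod (f z))\<^sup>2 + (cmod (g z))\<^sup>2)"
      by (simp add: norm_mult)
  qed
qed

lemma L2_fun_add: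
  assumes "L2_fun f" "L2_fun g"
  shows "L2_fun (\<lambda>z. f z + g z)"
  unfolding L2_fun_def
proof
  show m: "(\<lambda>z. f z + g z) \<in> borel_measurable circle"
    using assms unfolding L2_fun_def by auto
  show "integrable circle (\<lambda>z. (cmod (f z + g z))\<^sup>2)"
  proof (rule Bochner_Integration.integrable_bound)
    show "integrable circle (\<lambda>z. 2 * (cmod (f z))\<^sup>2 + 2 * (cmod (g z))\<^sup>2)"
      using assms unfolding L2_fun_def by auto
    show "(\<lambda>z. (cmod (f z + g z))\<^sup>2) \<in> borel_measurable circle"
      using m by measurable
    show "AE z in circle. norm ((cmod (f z + g z))\<^sup>2) \<le> norm (2 * (cmod (f z))\<^sup>2 + 2 * (cmod (g z))\<^sup>2)"
    proof (rule AE_I2)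
      fix z
      have "(cmod (f z + g z))\<^sup>2 \<le> (cmod (f z) + cmod (g z))\<^sup>2"
        by (intro power_mono norm_triangle_ineq) auto
      also have "\<dots> \<le> 2 * (cmod (f z))\<^sup>2 + 2 * (cmod (g z))\<^sup>2"
        using sum_squares_bound[of "cmod (f z)" "cmod (g z)"] by (simp add: power2_sum)
      finally show "norm ((cmod (f z + g z))\<^sup>2) \<le> norm (2 * (cmod (f z))\<^sup>2 + 2 * (cmod (g z))\<^sup>2)"
        by simp
    qed
  qed
qed

lemma L2_fun_uminus: "L2_fun f \<Longrightarrow> L2_fun (\<lambda>z. - f z)"
  using L2_fun_scale[of f "-1"] by simp

lemma L2_fun_diff: "L2_fun f \<Longrightarrow> L2_fun g \<Longrightarrow> L2_fun (\<lambda>z. f z - g z)"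
  using L2_fun_add[OF _ L2_fun_uminus, of f g] by simp

lemma Linf_L2_mult:
  assumes g: "Linf_fun g" and f: "L2_fun f"
  shows "L2_fun (\<lambda>z. g z * f z)"
  unfolding L2_fun_def
proof
  show m: "(\<lambda>z. g z * f z) \<in> borel_measurable circle"
    using assms unfolding L2_fun_def Linf_fun_def by auto
  obtain C where C: "AE z in circle. cmod (g z) \<le> C"
    using g unfolding Linf_fun_def by auto
  show "integrable circle (\<lambda>z. (cmod (g z * f z))\<^sup>2)"
  proof (rule Bochner_Integration.integrable_bound)
    show "integrable circle (\<lambda>z. C\<^sup>2 * (cmod (f z))\<^sup>2)"
      using f unfolding L2_fun_def by auto
    show "(\<lambda>z. (cmod (g z * f z))\<^sup>2) \<in> borel_measurable circle"
      using m by measurable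
    show "AE z in circle. norm ((cmod (g z * f z))\<^sup>2) \<le> norm (C\<^sup>2 * (cmod (f z))\<^sup>2)"
      using C
    proof eventually_elim
      case (elim z)
      then have "(cmod (g z))\<^sup>2 \<le> C\<^sup>2" by (intro power_mono) auto
      then show ?case by (simp add: norm_mult power_mult_distrib mult_right_mono)
    qed
  qed
qed

text \<open>
  Representatives are functions on the whole plane, but only their values on the circle, the space
  of the measure, matter.
\<close>

quotient_type Linf =
  "complex \<Rightarrow> complex" / partial: "\<lambda>f g. Linf_fun f \<and> Linf_fun g \<and> (AE z in circle. f z = g z)"
proof (rule part_equivpI)
  show "\<exists>f. Linf_fun f \<and> Linf_fun f \<and> (AE z in circle. f z = f z)"
    using Linf_fun_const by auto
  show "symp (\<lambda>f g. Linf_fun f \<and> Linf_fun g \<and> (AE z in circle. f z = g z))"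
    by (rule sympI) (auto elim: AE_mp)
  show "transp (\<lambda>f g. Linf_fun f \<and> Linf_fun g \<and> (AE z in circle. f z = g z))"
    by (rule transpI) (auto elim: eventually_elim2)
qed

instantiation Linf :: complex_vector
begin

lift_definition zero_Linf :: Linf is "\<lambda>z. 0"
  using Linf_fun_const by auto

lift_definition plus_Linf :: "Linf \<Rightarrow> Linf \<Rightarrow> Linf" is "\<lambda>f g z. f z + g z"
  by (auto simp: Linf_fun_add elim: eventually_elim2)

lift_definition uminus_Linf :: "Linf \<Rightarrow> Linf" is "\<lambda>f z. - f z"
  by (auto simp: Linf_fun_uminus elim: eventually_mono)

lift_definition minus_Linf :: "Linf \<Rightarrow> Linf \<Rightarrow> Linf" is "\<lambda>f g z. f z - g z"
  by (auto simp: Linf_fun_diff elim: eventually_elim2)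

lift_definition scaleC_Linf :: "complex \<Rightarrow> Linf \<Rightarrow> Linf" is "\<lambda>c f z. c * f z"
  by (auto simp: Linf_fun_scale elim: eventually_mono)

instance
  by standard (transfer; simp add: algebra_simps Linf_fun_add Linf_fun_scale
      Linf_fun_uminus Linf_fun_diff Linf_fun_const)+

end

instantiation Linf :: times
begin

lift_definition times_Linf :: "Linf \<Rightarrow> Linf \<Rightarrow> Linf" is "\<lambda>f g z. f z * g z"
  by (auto simp: Linf_fun_mult elim: eventually_elim2)

instance ..

end

lift_definition Linf_cnj :: "Linf \<Rightarrow> Linf" is "\<lambda>f z. cnj (f z)"
  by (auto simp: Linf_fun_cnj elim: eventually_mono)


section \<open>The Hilbert space of square-integrable functions on the circle\<close>

quotient_type L2 =
  "complex \<Rightarrow> complex" / partial: "\<lambda>f g. L2_fun f \<and> L2_fun g \<and> (AE z in circle. f z = g z)"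
proof (rule part_equivpI)
  show "\<exists>f. L2_fun f \<and> L2_fun f \<and> (AE z in circle. f z = f z)"
    using L2_fun_zero by auto
  show "symp (\<lambda>f g. L2_fun f \<and> L2_fun g \<and> (AE z in circle. f z = g z))"
    by (rule sympI) (auto elim: AE_mp)
  show "transp (\<lambda>f g. L2_fun f \<and> L2_fun g \<and> (AE z in circle. f z = g z))"
    by (rule transpI) (auto elim: eventually_elim2)
qed

instantiation L2 :: complex_vector
begin

lift_definition zero_L2 :: L2 is "\<lambda>z. 0"
  using L2_fun_zero by auto

lift_definition plus_L2 :: "L2 \<Rightarrow> L2 \<Rightarrow> L2" is "\<lambda>f g z. f z + g z"
  by (auto simp: L2_fun_add elim: eventually_elim2)

lift_definition uminus_L2 :: "L2 \<Rightarrow> L2" is "\<lambda>f z. - f z"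
  by (auto simp: L2_fun_uminus elim: eventually_mono)

lift_definition minus_L2 :: "L2 \<Rightarrow> L2 \<Rightarrow> L2" is "\<lambda>f g z. f z - g z"
  by (auto simp: L2_fun_diff elim: eventually_elim2)

lift_definition scaleC_L2 :: "complex \<Rightarrow> L2 \<Rightarrow> L2" is "\<lambda>c f z. c * f z"
  by (auto simp: L2_fun_scale elim: eventually_mono)

instance
  by standard (transfer; simp add: algebra_simps L2_fun_add L2_fun_scale
      L2_fun_uminus L2_fun_diff L2_fun_zero)+

end

lift_definition cinner_L2_raw :: "L2 \<Rightarrow> L2 \<Rightarrow> complex"
  is "\<lambda>f g. LINT z|circle. f z * cnj (g z)"
  by (rule integral_cong_AE) (auto simp: L2_fun_def elim: eventually_elim2)

lemma cinner_L2_add: "cinner_L2_raw (x + y) z = cinner_L2_raw x z + cinner_L2_raw y z"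
  by transfer (simp add: distrib_right Bochner_Integration.integral_add L2_fun_prod_integrable)

lemma cinner_L2_scaleC: "cinner_L2_raw (c *\<^sub>C x) y = c * cinner_L2_raw x y"
  by transfer (simp add: mult.assoc)

lemma cinner_L2_commute: "cinner_L2_raw x y = cnj (cinner_L2_raw y x)"
proof (transfer, goal_cases)
  case (1 f g)
  have "cnj (LINT z|circle. g z * cnj (f z)) = (LINT z|circle. cnj (g z * cnj (f z)))"
    by (rule Bochner_Integration.integral_cnj[symmetric])
  then show ?case by (simp add: mult.commute)
qed

lemma cinner_L2_self_rep:
  "L2_fun f \<Longrightarrow> (LINT z|circle. f z * cnj (f z)) = of_real (LINT z|circle. (cmod (f z))\<^sup>2)"
proof -
  have "(\<lambda>z. f z * cnj (f z)) = (\<lambda>z. complex_of_real ((cmod (f z))\<^sup>2))"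
    by (simp only: complex_norm_square)
  then show ?thesis by (simp only: integral_complex_of_real)
qed

lemma cinner_L2_self: "cinner_L2_raw x x \<in> \<real>\<^sub>\<ge>\<^sub>0"
proof (transfer, goal_cases)
  case (1 f)
  then show ?case by (simp add: cinner_L2_self_rep)
qed

lemma cinner_L2_eq_0: "cinner_L2_raw x x = 0 \<longleftrightarrow> x = 0"
proof (transfer, goal_cases)
  case (1 f)
  then have f: "L2_fun f" by simp
  have "(LINT z|circle. (cmod (f z))\<^sup>2) = 0 \<longleftrightarrow> (AE z in circle. (cmod (f z))\<^sup>2 = 0)"
    using f by (intro integral_nonneg_eq_0_iff_AE) (auto simp: L2_fun_def)
  then show ?case using f by (simp add: cinner_L2_self_rep L2_fun_zero)
qed

lemma cinner_L2_self_Re: "cinner_L2_raw x x = of_real (Re (cinner_L2_raw x x))"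
  using cinner_L2_self[of x] by (auto simp: nonneg_Reals_def)

instantiation L2 :: real_vector
begin

definition scaleR_L2 :: "real \<Rightarrow> L2 \<Rightarrow> L2" where
  "scaleR_L2 r x = complex_of_real r *\<^sub>C x"

instance
  by standard
    (simp_all add: scaleR_L2_def scaleC_add_right scaleC_add_left scaleC_scaleC scaleC_one)

end

instantiation L2 :: real_inner
begin

definition inner_L2 :: "L2 \<Rightarrow> L2 \<Rightarrow> real" where
  "inner_L2 x y = Re (cinner_L2_raw x y)"

definition norm_L2 :: "L2 \<Rightarrow> real" where
  "norm_L2 x = sqrt (inner x x)"

definition sgn_L2 :: "L2 \<Rightarrow> L2" where
  "sgn_L2 x = inverse (norm x) *\<^sub>R x"

definition dist_L2 :: "L2 \<Rightarrow> L2 \<Rightarrow> real" where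
  "dist_L2 x y = norm (x - y)"

definition uniformity_L2 :: "(L2 \<times> L2) filter" where
  "uniformity_L2 = (INF e\<in>{0<..}. principal {(x, y). dist x y < e})"

definition open_L2 :: "L2 set \<Rightarrow> bool" where
  "open_L2 U \<longleftrightarrow> (\<forall>x\<in>U. \<forall>\<^sub>F (x', y) in uniformity. x' = x \<longrightarrow> y \<in> U)"

instance
proof
  fix x y z :: L2 and r :: real and U :: "L2 set"
  show "sgn x = x /\<^sub>R norm x" by (rule sgn_L2_def)
  show "dist x y = norm (x - y)" by (rule dist_L2_def)
  show "uniformity = (INF e\<in>{0<..}. principal {(x::L2, y). dist x y < e})"
    by (rule uniformity_L2_def)
  show "open U \<longleftrightarrow> (\<forall>x\<in>U. \<forall>\<^sub>F (x', y) in uniformity. x' = x \<longrightarrow> y \<in> U)"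
    by (rule open_L2_def)
  show "inner x y = inner y x"
    using cinner_L2_commute[of x y] by (simp add: inner_L2_def)
  show "inner (x + y) z = inner x z + inner y z" by (simp add: inner_L2_def cinner_L2_add)
  show "inner (r *\<^sub>R x) y = r * inner x y"
    by (simp add: inner_L2_def scaleR_L2_def cinner_L2_scaleC)
  show "0 \<le> inner x x"
    using cinner_L2_self[of x] by (auto simp: inner_L2_def nonneg_Reals_def)
  show "inner x x = 0 \<longleftrightarrow> x = 0"
    using cinner_L2_eq_0[of x] cinner_L2_self_Re[of x]
    by (metis inner_L2_def of_real_0 zero_complex.sel(1))
  show "norm x = sqrt (inner x x)" by (rule norm_L2_def)
qed

end

instantiation L2 :: complex_inner
begin

definition cinner_L2 :: "L2 \<Rightarrow> L2 \<Rightarrow> complex" where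
  "cinner_L2 = cinner_L2_raw"

instance
  by standard
    (auto simp: cinner_L2_def scaleR_L2_def cinner_L2_add cinner_L2_scaleC cinner_L2_self
       cinner_L2_eq_0 norm_L2_def inner_L2_def intro: cinner_L2_commute)

end

lemma norm_abs_L2:
  assumes "L2_fun f"
  shows "(norm (abs_L2 f))\<^sup>2 = (LINT z|circle. (cmod (f z))\<^sup>2)"
proof -
  have "(norm (abs_L2 f))\<^sup>2 = inner (abs_L2 f) (abs_L2 f)"
    by (rule power2_norm_eq_inner)
  also have "\<dots> = Re (LINT z|circle. f z * cnj (f z))"
    using assms by (simp add: inner_L2_def cinner_L2_raw.abs_eq)
  also have "\<dots> = (LINT z|circle. (cmod (f z))\<^sup>2)"
    using assms by (simp add: cinner_L2_self_rep)
  finally show ?thesis .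
qed

lemma nn_integral_L2:
  assumes "L2_fun f"
  shows "(\<integral>\<^sup>+z. ennreal ((cmod (f z))\<^sup>2) \<partial>circle) = ennreal ((norm (abs_L2 f))\<^sup>2)"
  using assms by (subst norm_abs_L2) (auto simp: L2_fun_def intro!: nn_integral_eq_integral)

lemma L2_rep:
  obtains f where "L2_fun f" "x = abs_L2 f"
  by (induct x rule: L2.abs_induct) auto

lemma L2_Cauchy_convergent:
  fixes X :: "nat \<Rightarrow> L2"
  assumes "Cauchy X"
  shows "convergent X"
proof -
  have "\<forall>n. \<exists>f. L2_fun f \<and> X n = abs_L2 f"
    by (metis L2_rep)
  then obtain F where F: "\<And>n. L2_fun (F n)" and XF: "\<And>n. X n = abs_L2 (F n)"
    by metis
  have [measurable]: "F n \<in> borel_measurable circle" for n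
    using F[of n] by (simp add: L2_fun_def)
  have int: "(\<integral>\<^sup>+z. ennreal ((cmod (F m z - F n z))\<^sup>2) \<partial>circle) = ennreal ((dist (X m) (X n))\<^sup>2)"
    for m n
    using nn_integral_L2[OF L2_fun_diff[OF F[of m] F[of n]]] F
    by (simp add: XF dist_norm minus_L2.abs_eq)
  have "\<forall>k. \<exists>N. \<forall>m\<ge>N. \<forall>n\<ge>N. dist (X m) (X n) < (1/4)^k"
    using assms by (auto simp: Cauchy_def)
  then obtain N where N: "\<And>k m n. m \<ge> N k \<Longrightarrow> n \<ge> N k \<Longrightarrow> dist (X m) (X n) < (1/4)^k"
    by metis
  define r where "r k = (\<Sum>i\<le>k. N i)" for k
  have r_ge: "r k \<ge> N k" for k
    unfolding r_def by (rule member_le_sum) auto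
  have r_mono: "j \<le> k \<Longrightarrow> r j \<le> r k" for j k
    unfolding r_def by (rule sum_mono2) auto
  have r: "dist (X m) (X n) < (1/4)^k" if "m \<ge> r k" "n \<ge> r k" for k m n
    using N[of k m n] that r_ge[of k] by simp
  define G where "G k = F (r k)" for k
  have [measurable]: "G k \<in> borel_measurable circle" for k
    by (simp add: G_def)
  define h where "h k z = cmod (G (Suc k) z - G k z)" for k z
  have [measurable]: "h k \<in> borel_measurable circle" for k
    unfolding h_def by measurable
  have h_sq: "(\<integral>\<^sup>+z. ennreal ((h k z)\<^sup>2) \<partial>circle) \<le> ennreal ((1/16)^k)" for k
  proof -
    have "(dist (X (r (Suc k))) (X (r k)))\<^sup>2 \<le> ((1/4)^k)\<^sup>2"
      using r[of k "r (Suc k)" "r k"] r_mono[of k "Suc k"] by (intro power_mono) auto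
    also have "((1/4)^k)\<^sup>2 = (1/16 :: real)^k"
      by (simp add: power2_eq_square flip: power_mult_distrib)
    finally show ?thesis
      by (simp add: h_def G_def int ennreal_leI)
  qed
  have h_int: "(\<integral>\<^sup>+z. ennreal (h k z) \<partial>circle) \<le> ennreal (2 * (1/2)^k)" for k
  proof -
    have le: "h k z \<le> (1/2)^k + 2^k * (h k z)\<^sup>2" for z
    proof (cases "h k z \<le> (1/2)^k")
      case True
      then show ?thesis by (simp add: add_increasing2)
    next
      case False
      then have "1 \<le> 2^k * h k z"
        by (simp add: power_one_over field_simps)
      moreover have "0 \<le> h k z" by (simp add: h_def)
      ultimately have "1 * h k z \<le> (2^k * h k z) * h k z"
        by (rule mult_right_mono)
      then have "h k z \<le> 2^k * (h k z)\<^sup>2"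
        by (simp add: power2_eq_square mult.assoc)
      then show ?thesis by (simp add: add_increasing)
    qed
    have "(\<integral>\<^sup>+z. ennreal (h k z) \<partial>circle)
        \<le> (\<integral>\<^sup>+z. ennreal ((1/2)^k) + ennreal (2^k) * ennreal ((h k z)\<^sup>2) \<partial>circle)"
      by (rule nn_integral_mono) (metis le ennreal_leI ennreal_mult ennreal_plus zero_le_power
          zero_le_power2 mult_nonneg_nonneg zero_le_numeral zero_le_divide_1_iff)
    also have "\<dots> = ennreal ((1/2)^k) + ennreal (2^k) * (\<integral>\<^sup>+z. ennreal ((h k z)\<^sup>2) \<partial>circle)"
      by (simp add: nn_integral_add nn_integral_cmult emeasure_circle)
    also have "\<dots> \<le> ennreal ((1/2)^k) + ennreal (2^k) * ennreal ((1/16)^k)"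
      by (intro add_left_mono mult_left_mono h_sq) auto
    also have "\<dots> = ennreal ((1/2)^k + 2^k * (1/16)^k)"
      by (simp add: ennreal_mult ennreal_plus)
    also have "\<dots> \<le> ennreal (2 * (1/2)^k)"
    proof (rule ennreal_leI)
      have "(2::real)^k * (1/16)^k = (1/8)^k"
        by (simp flip: power_mult_distrib)
      also have "\<dots> \<le> (1/2)^k" by (rule power_mono) auto
      finally show "(1/2)^k + 2^k * (1/16)^k \<le> 2 * (1/2 :: real)^k" by simp
    qed
    finally show ?thesis .
  qed
  have "(\<integral>\<^sup>+z. (\<Sum>k. ennreal (h k z)) \<partial>circle) = (\<Sum>k. \<integral>\<^sup>+z. ennreal (h k z) \<partial>circle)"
    by (rule nn_integral_suminf) measurable
  also have "\<dots> \<le> (\<Sum>k. ennreal (2 * (1/2)^k))"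
    by (intro suminf_le h_int) auto
  also have "\<dots> = ennreal (\<Sum>k. 2 * (1/2)^k)"
    by (intro suminf_ennreal2 summable_mult summable_geometric) auto
  also have "\<dots> < \<infinity>" by simp
  finally have "AE z in circle. (\<Sum>k. ennreal (h k z)) \<noteq> \<infinity>"
    by (intro nn_integral_PInf_AE) auto
  then have conv: "AE z in circle. (\<lambda>k. G k z) \<longlonglongrightarrow> lim (\<lambda>k. G k z)"
  proof eventually_elim
    case (elim z)
    then have "summable (\<lambda>k. h k z)"
      by (intro summable_suminf_not_top) (auto simp: h_def)
    then have "summable (\<lambda>k. G (Suc k) z - G k z)"
      unfolding h_def by (rule summable_norm_cancel)
    then have "convergent (\<lambda>n. G 0 z + (\<Sum>k<n. G (Suc k) z - G k z))"
      by (intro convergent_add convergent_const) (simp add: summable_iff_convergent)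
    moreover have "G 0 z + (\<Sum>k<n. G (Suc k) z - G k z) = G n z" for n
      by (induction n) (simp_all flip: add.assoc)
    ultimately have "convergent (\<lambda>k. G k z)"
      by simp
    then show ?case by (simp add: convergent_LIMSEQ_iff)
  qed
  define f where "f z = lim (\<lambda>k. G k z)" for z
  have [measurable]: "f \<in> borel_measurable circle"
    unfolding f_def by measurable
  have lim: "(\<integral>\<^sup>+z. ennreal ((cmod (F n z - f z))\<^sup>2) \<partial>circle) \<le> ennreal (((1/4)^j)\<^sup>2)"
    if n: "n \<ge> r j" for n j
  proof -
    have "(\<integral>\<^sup>+z. ennreal ((cmod (F n z - f z))\<^sup>2) \<partial>circle)
        = (\<integral>\<^sup>+z. liminf (\<lambda>k. ennreal ((cmod (F n z - G k z))\<^sup>2)) \<partial>circle)"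
    proof (rule nn_integral_cong_AE, use conv in eventually_elim)
      case (elim z)
      have "(\<lambda>k. ennreal ((cmod (F n z - G k z))\<^sup>2)) \<longlonglongrightarrow> ennreal ((cmod (F n z - f z))\<^sup>2)"
        unfolding f_def by (intro tendsto_ennrealI tendsto_intros elim)
      then show ?case
        by (intro lim_imp_Liminf[symmetric] sequentially_bot)
    qed
    also have "\<dots> \<le> liminf (\<lambda>k. \<integral>\<^sup>+z. ennreal ((cmod (F n z - G k z))\<^sup>2) \<partial>circle)"
      by (rule nn_integral_liminf) measurable
    also have "\<dots> \<le> ennreal (((1/4)^j)\<^sup>2)"
    proof (rule Liminf_le)
      show "\<forall>\<^sub>F k in sequentially. (\<integral>\<^sup>+z. ennreal ((cmod (F n z - G k z))\<^sup>2) \<partial>circle) \<le> ennreal (((1/4)^j)\<^sup>2)"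
        using eventually_ge_at_top[of j]
      proof eventually_elim
        case (elim k)
        then have "dist (X n) (X (r k)) < (1/4)^j" using r n r_mono by blast
        then show ?case
          unfolding G_def int by (intro ennreal_leI power_mono) auto
      qed
    qed simp
    finally show ?thesis .
  qed
  have diff: "L2_fun (\<lambda>z. F n z - f z)" if "n \<ge> r 0" for n
    unfolding L2_fun_def
  proof
    show "integrable circle (\<lambda>z. (cmod (F n z - f z))\<^sup>2)"
      using lim[OF that] by (intro integrableI_nonneg) (auto simp: less_top[symmetric] top_unique)
  qed measurable
  have f: "L2_fun f"
    using L2_fun_diff[OF F[of "r 0"] diff[of "r 0"]] by simp
  have "(\<lambda>n. X n) \<longlonglongrightarrow> abs_L2 f"
  proof (rule metric_LIMSEQ_I)
    fix e :: real assume "e > 0"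
    then obtain j where j: "(1/4)^j < e"
      using real_arch_pow_inv[of e "1/4"] by auto
    show "\<exists>n0. \<forall>n\<ge>n0. dist (X n) (abs_L2 f) < e"
    proof (intro exI allI impI)
      fix n assume n: "n \<ge> r j"
      then have n0: "n \<ge> r 0" using r_mono[of 0 j] by simp
      have "ennreal ((dist (X n) (abs_L2 f))\<^sup>2) \<le> ennreal (((1/4)^j)\<^sup>2)"
        using lim[OF n] nn_integral_L2[OF diff[OF n0]] F f
        by (simp add: XF dist_norm minus_L2.abs_eq)
      then have "(dist (X n) (abs_L2 f))\<^sup>2 \<le> ((1/4)^j)\<^sup>2"
        by (subst (asm) ennreal_le_iff) auto
      then have "dist (X n) (abs_L2 f) \<le> (1/4)^j"
        by (rule power2_le_imp_le) auto
      then show "dist (X n) (abs_L2 f) < e" using j by simp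
    qed
  qed
  then show ?thesis by (auto simp: convergent_def)
qed

lemma L2_not_trivial: "\<exists>x::L2. x \<noteq> 0"
proof
  have "(norm (abs_L2 (\<lambda>z. 1)))\<^sup>2 = 1"
    by (subst norm_abs_L2[OF L2_fun_one]) (simp add: measure_def emeasure_circle)
  then show "abs_L2 (\<lambda>z. 1) \<noteq> 0" by auto
qed

instance L2 :: complex_hilbert
  by standard (fact L2_Cauchy_convergent L2_not_trivial)+


section \<open>Multiplication operators\<close>

lift_definition mult_L2 :: "Linf \<Rightarrow> L2 \<Rightarrow> L2" is "\<lambda>g f z. g z * f z"
  by (auto simp: Linf_L2_mult elim: eventually_elim2)

lemma mult_L2_bounded_linear: "bounded_linear (mult_L2 g)"
proof (rule Linf.abs_induct[of _ g], goal_cases)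
  case (1 u)
  then have u: "Linf_fun u" by simp
  then obtain C where "AE z in circle. cmod (u z) \<le> C"
    unfolding Linf_fun_def by auto
  then have C: "AE z in circle. cmod (u z) \<le> max C 0"
    by eventually_elim simp
  show ?case
  proof (rule bounded_linear_intro)
    fix x y :: L2 and c :: real
    show "mult_L2 (abs_Linf u) (x + y) = mult_L2 (abs_Linf u) x + mult_L2 (abs_Linf u) y"
      by (rule L2_rep[of x], rule L2_rep[of y])
        (use u in \<open>simp add: mult_L2.abs_eq plus_L2.abs_eq L2_fun_add Linf_L2_mult distrib_left\<close>)
    show "mult_L2 (abs_Linf u) (c *\<^sub>R x) = c *\<^sub>R mult_L2 (abs_Linf u) x"
      by (rule L2_rep[of x])
        (use u in \<open>simp add: scaleR_L2_def mult_L2.abs_eq scaleC_L2.abs_eq L2_fun_scale Linf_L2_mult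
           mult.left_commute\<close>)
    obtain f where f: "L2_fun f" and x: "x = abs_L2 f" by (rule L2_rep)
    have "(norm (mult_L2 (abs_Linf u) x))\<^sup>2 = (LINT z|circle. (cmod (u z * f z))\<^sup>2)"
      using u f by (simp add: x mult_L2.abs_eq norm_abs_L2 Linf_L2_mult)
    also have "\<dots> \<le> (LINT z|circle. (max C 0)\<^sup>2 * (cmod (f z))\<^sup>2)"
    proof (rule integral_mono_AE)
      show "integrable circle (\<lambda>z. (cmod (u z * f z))\<^sup>2)"
        using Linf_L2_mult[OF u f] by (simp add: L2_fun_def)
      show "integrable circle (\<lambda>z. (max C 0)\<^sup>2 * (cmod (f z))\<^sup>2)"
        using f by (simp add: L2_fun_def)
      show "AE z in circle. (cmod (u z * f z))\<^sup>2 \<le> (max C 0)\<^sup>2 * (cmod (f z))\<^sup>2"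
        using C
      proof eventually_elim
        case (elim z)
        then have "(cmod (u z))\<^sup>2 \<le> (max C 0)\<^sup>2" by (intro power_mono) auto
        then show ?case by (simp add: norm_mult power_mult_distrib mult_right_mono)
      qed
    qed
    also have "\<dots> = (norm x * max C 0)\<^sup>2"
      using f by (simp add: x norm_abs_L2 power_mult_distrib mult.commute)
    finally show "norm (mult_L2 (abs_Linf u) x) \<le> norm x * max C 0"
      by (rule power2_le_imp_le) simp
  qed
qed

lift_definition mult_op :: "Linf \<Rightarrow> L2 bop" is mult_L2
proof (intro CollectI conjI allI mult_L2_bounded_linear)
  fix g :: Linf and c :: complex and x :: L2
  show "mult_L2 g (c *\<^sub>C x) = c *\<^sub>C mult_L2 g x"
    by transfer (simp add: Linf_L2_mult L2_fun_scale mult.left_commute)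
qed

end

theory Submission
  imports Defs
begin

text \<open>
  The map \<open>g \<mapsto> M\<^sub>g\<close> is an injective homomorphism of algebras that sends complex conjugation to the
  adjoint, and \<open>M\<^sub>r\<close> with \<open>r\<close> real is positive exactly when \<open>r \<ge> 0\<close> almost everywhere
  (\<open>positive_mult_op_iff\<close>).  Hence everything about \<open>\<phi>\<close> can be read off from functions on the circle.
  The axioms of an inner product are pointwise identities.  For the induced norm,
  \<open>\<phi> f f = M\<^sub>g\<close> with \<open>g = \<bar>f\<bar>\<^sup>2\<close>, and multiplication by \<open>\<bar>f\<bar>\<close> is a positive operator with this square;
  since positive square roots are unique (\<open>positive_sqrt_unique\<close>), the induced norm of \<open>f\<close> is
  multiplication by \<open>\<bar>f\<bar>\<close>.

  Now the axioms of an operator-valued norm are those of the modulus, applied almost everywhere.  Since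
  \<open>\<phi> f g\<close> is the product of \<open>M\<^sub>f\<close> and the adjoint of \<open>M\<^sub>g\<close>, and multiplication by a function and by its
  modulus have the same operator norm, \<open>\<phi>\<close> is bounded with constant \<open>1\<close>.  Finally, the induced norm
  of \<open>f\<close> is at most \<open>e\<close> times the identity exactly when \<open>\<bar>f\<bar> \<le> e\<close> almost everywhere
  (\<open>mult_op_abs_le_iff\<close>), so completeness is the completeness of \<open>L\<^sup>\<infinity>\<close>
  (\<open>op_complete_mult_op_abs\<close>).
\<close>

section \<open>Positive operators and their square roots\<close>

lemma cinner_add_right: "cinner x (y + z) = cinner x y + cinner x (z :: 'a::complex_inner)"
  by (subst (1 2 3) cinner_commute) (simp add: cinner_add_left)

lemma cinner_scaleC_right: "cinner x (c *\<^sub>C y) = cnj c * cinner x (y :: 'a::complex_inner)"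
  by (subst (1 2) cinner_commute) (simp add: cinner_scaleC_left)

lemma cinner_diff_left: "cinner (x - y) z = cinner x z - cinner y (z :: 'a::complex_inner)"
  using cinner_add_left[of "x - y" y z] by simp

lemma cinner_diff_right: "cinner x (y - z) = cinner x y - cinner x (z :: 'a::complex_inner)"
  using cinner_add_right[of x "y - z" z] by simp

lemma Re_cinner_self: "Re (cinner x x) = (norm (x :: 'a::complex_inner))\<^sup>2"
  using cinner_nonneg[of x] by (simp add: norm_eq_sqrt_cinner complex_nonneg_Reals_iff)

lemma Re_cinner_commute: "Re (cinner x y) = Re (cinner y (x :: 'a::complex_inner))"
  by (subst cinner_commute) simp

lemma norm_diff_squared:
  "(norm (x - y :: 'a::complex_inner))\<^sup>2 = (norm x)\<^sup>2 - 2 * Re (cinner x y) + (norm y)\<^sup>2"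
  by (simp add: cinner_diff_left cinner_diff_right Re_cinner_commute[of y x]
      flip: Re_cinner_self)

lemma Re_cinner_le: "Re (cinner x y) \<le> norm x * norm (y :: 'a::complex_inner)"
proof (cases "x = 0 \<or> y = 0")
  case True
  then show ?thesis
    using cinner_diff_left[of x x y] cinner_diff_right[of x y y] by auto
next
  case False
  have "0 \<le> (norm (norm y *\<^sub>R x - norm x *\<^sub>R y))\<^sup>2"
    by simp
  also have "\<dots> = 2 * (norm x * norm y) * (norm x * norm y - Re (cinner x y))"
    by (subst norm_diff_squared)
       (simp add: scaleR_scaleC cinner_scaleC_left cinner_scaleC_right norm_scaleC
         power2_eq_square algebra_simps)
  finally have "0 \<le> 2 * (norm x * norm y) * (norm x * norm y - Re (cinner x y))" .
  moreover have "0 < 2 * (norm x * norm y)"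
    using False by simp
  ultimately show ?thesis
    using zero_le_mult_iff[of "2 * (norm x * norm y)" "norm x * norm y - Re (cinner x y)"]
    by linarith
qed

lemma bounded_linear_bop_apply: "bounded_linear (bop_apply T)"
  using bop_apply[of T] by simp

lemma bop_apply_scaleC: "bop_apply T (c *\<^sub>C x) = c *\<^sub>C bop_apply T x"
  using bop_apply[of T] by simp

lemma bop_eqI: "(\<And>x. bop_apply S x = bop_apply T x) \<Longrightarrow> S = T"
  by (simp add: bop_apply_inject[symmetric] fun_eq_iff)

lemmas bop_apply_add = linear_add[OF bounded_linear.linear[OF bounded_linear_bop_apply]]
lemmas bop_apply_diff = linear_diff[OF bounded_linear.linear[OF bounded_linear_bop_apply]]
lemmas bop_apply_simps = zero_bop.rep_eq plus_bop.rep_eq minus_bop.rep_eq scaleC_bop.rep_eq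
  bop_id.rep_eq bop_comp.rep_eq

lemma norm_bop_apply_le: "norm (bop_apply T x) \<le> bop_norm T * norm x"
  by (simp add: bop_norm.rep_eq onorm[OF bounded_linear_bop_apply])

lemma bop_norm_nonneg: "0 \<le> bop_norm T"
  by (simp add: bop_norm.rep_eq onorm_pos_le[OF bounded_linear_bop_apply])

lemma positive_op_Re: "positive_op P \<Longrightarrow> 0 \<le> Re (cinner (bop_apply P h) h)"
  by (simp add: positive_op_def complex_nonneg_Reals_iff)

text \<open>Over the complex numbers the quadratic form determines the sesquilinear form: evaluating it
  at \<open>x + y\<close> and at \<open>x + i y\<close> shows that a form with real diagonal is Hermitian.\<close>

lemma positive_op_symmetric:
  assumes "positive_op P"
  shows "cinner (bop_apply P x) y = cinner x (bop_apply P y)"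
proof -
  let ?B = "\<lambda>x y. cinner (bop_apply P x) y"
  have im: "Im (?B h h) = 0" for h
    using assms by (simp add: positive_op_def complex_nonneg_Reals_iff)
  have "Im (?B x y) = - Im (?B y x)"
    using im[of "x + y"] im[of x] im[of y]
    by (simp add: bop_apply_add cinner_add_left cinner_add_right)
  moreover have "Re (?B x y) = Re (?B y x)"
    using im[of "x + \<i> *\<^sub>C y"] im[of x] im[of y]
    by (simp add: bop_apply_add bop_apply_scaleC cinner_add_left cinner_add_right
        cinner_scaleC_left cinner_scaleC_right)
  ultimately have "?B x y = cnj (?B y x)"
    by (simp add: complex_eq_iff)
  then show ?thesis
    by (simp flip: cinner_commute)
qed

text \<open>Where the quadratic form of \<open>P\<close> is small, \<open>P\<close> itself is small.  The bound comes from
  nonnegativity of the form at \<open>x - P x / K\<close>, scaled by \<open>K\<close>.\<close>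

lemma positive_op_norm_le:
  assumes P: "positive_op P" and K: "bop_norm P \<le> K" "0 < K"
  shows "(norm (bop_apply P x))\<^sup>2 \<le> K * Re (cinner (bop_apply P x) x)"
proof -
  let ?y = "bop_apply P x"
  let ?a = "Re (cinner ?y x)"
  have sym: "cinner (bop_apply P ?y) x = cinner ?y ?y"
    by (rule positive_op_symmetric[OF P])
  have c: "Re (cinner (bop_apply P ?y) ?y) \<le> K * (norm ?y)\<^sup>2"
  proof -
    have "Re (cinner (bop_apply P ?y) ?y) \<le> norm (bop_apply P ?y) * norm ?y"
      by (rule Re_cinner_le)
    also have "\<dots> \<le> (K * norm ?y) * norm ?y"
      using norm_bop_apply_le[of P ?y] mult_right_mono[OF K(1), of "norm ?y"]
      by (intro mult_right_mono) auto
    finally show ?thesis by (simp add: power2_eq_square mult.assoc)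
  qed
  have "0 \<le> Re (cinner (bop_apply P (complex_of_real K *\<^sub>C x - ?y)) (complex_of_real K *\<^sub>C x - ?y))"
    by (rule positive_op_Re[OF P])
  also have "\<dots> = K\<^sup>2 * ?a - 2 * K * (norm ?y)\<^sup>2 + Re (cinner (bop_apply P ?y) ?y)"
    by (simp add: bop_apply_diff bop_apply_scaleC cinner_diff_left cinner_diff_right
        cinner_scaleC_left cinner_scaleC_right sym Re_cinner_self power2_eq_square algebra_simps)
  also have "\<dots> \<le> K\<^sup>2 * ?a - 2 * K * (norm ?y)\<^sup>2 + K * (norm ?y)\<^sup>2"
    using c by simp
  finally have "K * (norm ?y)\<^sup>2 \<le> K * (K * ?a)"
    by (simp add: power2_eq_square algebra_simps)
  then show ?thesis using K(2) by simp
qed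

lemma bop_norm_eq_0: "bop_norm T = 0 \<longleftrightarrow> T = 0"
proof
  assume "bop_norm T = 0"
  then show "T = 0"
    using norm_bop_apply_le[of T] by (intro bop_eqI) (simp add: bop_apply_simps)
next
  assume "T = 0"
  then show "bop_norm T = 0"
    by (simp add: bop_norm.rep_eq zero_bop.rep_eq onorm_zero)
qed

text \<open>
  Put \<open>D = S - T\<close> and \<open>A = S + T\<close>.  Since \<open>S\<^sup>2 = T\<^sup>2\<close>, these anticommute: \<open>A D = T S - S T = - D A\<close>.
  As \<open>D\<close> is self-adjoint, \<open>(A D\<^sup>2 x, x) = - (A D x, D x) \<le> 0\<close> for all \<open>x\<close>.  Were \<open>D\<close> of norm
  \<open>L > 0\<close>, unit vectors \<open>x\<close> with \<open>\<parallel>D x\<parallel>\<close> close to \<open>L\<close> would make \<open>D\<^sup>2 x\<close> close to \<open>L\<^sup>2 x\<close>, so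
  \<open>L\<^sup>2 (A x, x)\<close> would be at most a small number.  But \<open>(A x, x)\<close> controls \<open>\<parallel>S x\<parallel>\<^sup>2\<close> and
  \<open>\<parallel>T x\<parallel>\<^sup>2\<close>, hence \<open>\<parallel>D x\<parallel>\<^sup>2\<close>, which is close to \<open>L\<^sup>2\<close>.\<close>

lemma positive_sqrt_unique:
  assumes S: "positive_op S" and T: "positive_op T" and eq: "bop_comp S S = bop_comp T T"
  shows "S = T"
proof (rule ccontr)
  assume "S \<noteq> T"
  define D where "D = S - T"
  define A where "A = S + T"
  define L where "L = bop_norm D"
  define K where "K = 1 + bop_norm S + bop_norm T"
  have K: "bop_norm S \<le> K" "bop_norm T \<le> K" "0 < K"
    using bop_norm_nonneg[of S] bop_norm_nonneg[of T] by (auto simp: K_def)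
  have "L > 0"
    using \<open>S \<noteq> T\<close> bop_norm_nonneg[of D] bop_norm_eq_0[of D] by (simp add: L_def D_def)
  have SS: "bop_apply S (bop_apply S x) = bop_apply T (bop_apply T x)" for x
    using arg_cong[OF eq, of "\<lambda>U. bop_apply U x"] by (simp add: bop_apply_simps)
  have anti: "bop_apply A (bop_apply D x) = - bop_apply D (bop_apply A x)" for x
    by (simp add: A_def D_def bop_apply_simps bop_apply_add bop_apply_diff SS)
  have symD: "cinner (bop_apply D x) y = cinner x (bop_apply D y)" for x y
    by (simp add: D_def bop_apply_simps cinner_diff_left cinner_diff_right
        positive_op_symmetric[OF S] positive_op_symmetric[OF T])
  have posA: "0 \<le> Re (cinner (bop_apply A x) x)" for x
    using positive_op_Re[OF S, of x] positive_op_Re[OF T, of x]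
    by (simp add: A_def bop_apply_simps cinner_add_left)
  have neg: "Re (cinner (bop_apply A (bop_apply D (bop_apply D x))) x) \<le> 0" for x
  proof -
    have "cinner (bop_apply A (bop_apply D (bop_apply D x))) x
        = - cinner (bop_apply A (bop_apply D x)) (bop_apply D x)"
      using cinner_diff_left[of 0 "bop_apply D (bop_apply A (bop_apply D x))" x]
        cinner_diff_left[of 0 0 x] by (simp add: anti[of "bop_apply D x"] symD)
    then show ?thesis using posA[of "bop_apply D x"] by simp
  qed
  have normA: "norm (bop_apply A y) \<le> 2 * K * norm y" for y
  proof -
    have "norm (bop_apply A y) \<le> norm (bop_apply S y) + norm (bop_apply T y)"
      by (simp add: A_def bop_apply_simps norm_triangle_ineq)
    also have "\<dots> \<le> K * norm y + K * norm y"
      using norm_bop_apply_le[of S y] norm_bop_apply_le[of T y]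
        mult_right_mono[OF K(1), of "norm y"] mult_right_mono[OF K(2), of "norm y"] by simp
    finally show ?thesis by simp
  qed
  have DA: "(norm (bop_apply D x))\<^sup>2 \<le> 2 * K * Re (cinner (bop_apply A x) x)" for x
  proof -
    let ?s = "norm (bop_apply S x)" and ?t = "norm (bop_apply T x)"
    have "norm (bop_apply D x) \<le> ?s + ?t"
      by (simp add: D_def bop_apply_simps norm_triangle_ineq4)
    then have "(norm (bop_apply D x))\<^sup>2 \<le> (?s + ?t)\<^sup>2"
      by (intro power_mono) auto
    also have "\<dots> \<le> 2 * ?s\<^sup>2 + 2 * ?t\<^sup>2"
      using sum_squares_bound[of ?s ?t] by (simp add: power2_sum)
    finally show ?thesis
      using positive_op_norm_le[OF S K(1,3), of x] positive_op_norm_le[OF T K(2,3), of x]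
      by (simp add: A_def bop_apply_simps cinner_add_left algebra_simps)
  qed
  have bound: "L\<^sup>2 * d\<^sup>2 \<le> 4 * K\<^sup>2 * (L * sqrt (L\<^sup>2 - d\<^sup>2))" if d: "0 \<le> d" "d < L" for d
  proof -
    \<comment> \<open>A unit vector almost attaining the norm of \<open>D\<close> is an approximate eigenvector of \<open>D\<^sup>2\<close>.\<close>
    obtain x0 where x0: "d * norm x0 < norm (bop_apply D x0)"
    proof (rule ccontr)
      assume "\<not> thesis"
      then have "norm (bop_apply D x) \<le> d * norm x" for x
        using that by (meson not_less)
      then have "onorm (bop_apply D) \<le> d"
        by (intro onorm_bound d)
      then show False using d by (simp add: L_def bop_norm.rep_eq)
    qed
    then have "x0 \<noteq> 0"
      using bop_apply_diff[of D 0 0] by auto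
    define x where "x = complex_of_real (inverse (norm x0)) *\<^sub>C x0"
    have nx: "norm x = 1" using \<open>x0 \<noteq> 0\<close> by (simp add: x_def norm_scaleC norm_inverse)
    have "d < norm (bop_apply D x)"
      using x0 \<open>x0 \<noteq> 0\<close> by (simp add: x_def bop_apply_scaleC norm_scaleC norm_inverse norm_divide field_simps)
    then have dx: "d\<^sup>2 \<le> (norm (bop_apply D x))\<^sup>2"
      using d by (intro power_mono) auto
    let ?w = "complex_of_real (L\<^sup>2) *\<^sub>C x - bop_apply D (bop_apply D x)"
    have "norm (bop_apply D (bop_apply D x)) \<le> L * norm (bop_apply D x)"
      unfolding L_def by (rule norm_bop_apply_le)
    then have DD: "(norm (bop_apply D (bop_apply D x)))\<^sup>2 \<le> L\<^sup>2 * (norm (bop_apply D x))\<^sup>2"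
      using power_mono[of _ _ 2] by (fastforce simp flip: power_mult_distrib)
    have "(norm ?w)\<^sup>2 = L^4 - 2 * L\<^sup>2 * (norm (bop_apply D x))\<^sup>2
        + (norm (bop_apply D (bop_apply D x)))\<^sup>2"
      by (subst norm_diff_squared)
        (simp add: norm_scaleC nx cinner_scaleC_left norm_power Re_cinner_self
          symD[of x "bop_apply D x", symmetric] del: of_real_power)
    also have "\<dots> \<le> L^4 - L\<^sup>2 * (norm (bop_apply D x))\<^sup>2"
      using DD by simp
    also have "\<dots> \<le> L^4 - L\<^sup>2 * d\<^sup>2"
      using dx by (simp add: mult_left_mono)
    also have "\<dots> = L\<^sup>2 * (L\<^sup>2 - d\<^sup>2)"
      by (simp add: algebra_simps power4_eq_xxxx power2_eq_square)
    finally have w: "norm ?w \<le> L * sqrt (L\<^sup>2 - d\<^sup>2)"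
      using \<open>L > 0\<close> real_le_rsqrt by (fastforce simp: real_sqrt_mult)
    have "L\<^sup>2 * d\<^sup>2 \<le> L\<^sup>2 * (2 * K * Re (cinner (bop_apply A x) x))"
      using dx DA[of x] by (intro mult_left_mono) auto
    also have "\<dots> = 2 * K * (L\<^sup>2 * Re (cinner (bop_apply A x) x))"
      by simp
    also have "\<dots> \<le> 2 * K * Re (cinner (bop_apply A ?w) x)"
      using neg[of x] K(3)
      by (intro mult_left_mono)
        (auto simp: bop_apply_diff bop_apply_scaleC cinner_diff_left cinner_scaleC_left
          simp del: of_real_power)
    also have "\<dots> \<le> 2 * K * (2 * K * (L * sqrt (L\<^sup>2 - d\<^sup>2)))"
    proof (rule mult_left_mono)
      have "Re (cinner (bop_apply A ?w) x) \<le> norm (bop_apply A ?w)"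
        using Re_cinner_le[of "bop_apply A ?w" x] nx by simp
      also have "\<dots> \<le> 2 * K * norm ?w" by (rule normA)
      also have "\<dots> \<le> 2 * K * (L * sqrt (L\<^sup>2 - d\<^sup>2))"
        using w K(3) by (intro mult_left_mono) auto
      finally show "Re (cinner (bop_apply A ?w) x) \<le> \<dots>" .
    qed (use K(3) in simp)
    finally show ?thesis by (simp add: power2_eq_square mult.assoc)
  qed
  \<comment> \<open>The norm of \<open>D\<close> need not be attained, so \<open>d = L\<close> is reached only as a limit, where the
    right-hand side vanishes.\<close>
  have "L\<^sup>2 * L\<^sup>2 \<le> 4 * K\<^sup>2 * (L * sqrt (L\<^sup>2 - L\<^sup>2))"
  proof (rule tendsto_le)
    show "((\<lambda>d. 4 * K\<^sup>2 * (L * sqrt (L\<^sup>2 - d\<^sup>2))) \<longlongrightarrow> 4 * K\<^sup>2 * (L * sqrt (L\<^sup>2 - L\<^sup>2))) (at_left L)"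
      by (intro tendsto_intros)
    show "((\<lambda>d. L\<^sup>2 * d\<^sup>2) \<longlongrightarrow> L\<^sup>2 * L\<^sup>2) (at_left L)"
      by (intro tendsto_intros)
    show "\<forall>\<^sub>F d in at_left L. L\<^sup>2 * d\<^sup>2 \<le> 4 * K\<^sup>2 * (L * sqrt (L\<^sup>2 - d\<^sup>2))"
      using eventually_at_left_real[OF \<open>0 < L\<close>] by eventually_elim (auto intro: bound)
  qed simp
  then show False using \<open>L > 0\<close> by (simp add: mult_le_0_iff)
qed

text \<open>Square root and adjoint are definite descriptions; uniqueness turns a candidate that satisfies
  the defining property into their value.\<close>

lemma op_sqrt_eqI:
  assumes "positive_op S" "bop_comp S S = P"
  shows "op_sqrt P = S"
  unfolding op_sqrt_def using assms by (intro the_equality) (auto intro: positive_sqrt_unique)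

lemma bop_adj_eqI:
  assumes "\<And>x y. cinner (bop_apply T x) y = cinner x (bop_apply S y)"
  shows "bop_adj T = S"
  unfolding bop_adj_def
proof (rule the_equality)
  fix S' assume S': "\<forall>x y. cinner (bop_apply T x) y = cinner x (bop_apply S' y)"
  show "S' = S"
  proof (rule bop_eqI)
    fix y
    let ?d = "bop_apply S' y - bop_apply S y"
    have "cinner ?d ?d = 0"
      using assms S' by (simp add: cinner_diff_right flip: assms)
    then show "bop_apply S' y = bop_apply S y"
      by (simp add: cinner_eq_zero_iff)
  qed
qed (use assms in simp)

section \<open>The algebra of multiplication operators\<close>

lemma Linf_rep:
  obtains u where "Linf_fun u" "f = abs_Linf u"
  by (induct f rule: Linf.abs_induct) auto

lemma abs_Linf_eq_iff:
  assumes "Linf_fun u" "Linf_fun v"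
  shows "abs_Linf u = abs_Linf v \<longleftrightarrow> (AE z in circle. u z = v z)"
  using assms Quotient3_rel[OF Quotient3_Linf, of u v] by auto

lemma Linf_fun_cmod: "Linf_fun u \<Longrightarrow> Linf_fun (\<lambda>z. complex_of_real (cmod (u z)))"
  unfolding Linf_fun_def by auto

lift_definition Linf_abs :: "Linf \<Rightarrow> Linf" is "\<lambda>f z. complex_of_real (cmod (f z))"
  by (auto simp: Linf_fun_cmod elim: eventually_mono)

lemma mult_L2_abs:
  "Linf_fun u \<Longrightarrow> L2_fun f \<Longrightarrow> mult_L2 (abs_Linf u) (abs_L2 f) = abs_L2 (\<lambda>z. u z * f z)"
  by (simp add: mult_L2.abs_eq)

lemma mult_op_add: "mult_op (f + g) = mult_op f + mult_op g"
proof (rule bop_eqI, simp only: bop_apply_simps mult_op.rep_eq)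
  fix x show "mult_L2 (f + g) x = mult_L2 f x + mult_L2 g x"
    by transfer (simp add: Linf_L2_mult L2_fun_add Linf_fun_add distrib_right)
qed

lemma mult_op_diff: "mult_op (f - g) = mult_op f - mult_op g"
proof (rule bop_eqI, simp only: bop_apply_simps mult_op.rep_eq)
  fix x show "mult_L2 (f - g) x = mult_L2 f x - mult_L2 g x"
    by transfer (simp add: Linf_L2_mult L2_fun_diff Linf_fun_diff left_diff_distrib)
qed

lemma mult_op_scaleC: "mult_op (c *\<^sub>C f) = c *\<^sub>C mult_op f"
proof (rule bop_eqI, simp only: bop_apply_simps mult_op.rep_eq)
  fix x show "mult_L2 (c *\<^sub>C f) x = c *\<^sub>C mult_L2 f x"
    by transfer (simp add: Linf_L2_mult L2_fun_scale Linf_fun_scale mult.assoc)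
qed

lemma mult_op_mult: "mult_op (f * g) = bop_comp (mult_op f) (mult_op g)"
proof (rule bop_eqI, simp only: bop_apply_simps mult_op.rep_eq)
  fix x show "mult_L2 (f * g) x = mult_L2 f (mult_L2 g x)"
    by transfer (simp add: Linf_L2_mult Linf_fun_mult mult.assoc)
qed

lemma mult_op_one: "mult_op (abs_Linf (\<lambda>z. 1)) = bop_id"
proof (rule bop_eqI, simp only: bop_apply_simps mult_op.rep_eq)
  fix x :: L2
  obtain f where "L2_fun f" "x = abs_L2 f" by (rule L2_rep)
  then show "mult_L2 (abs_Linf (\<lambda>z. 1)) x = x"
    by (simp add: mult_L2_abs Linf_fun_const)
qed

lemma mult_op_0: "mult_op 0 = 0"
  using mult_op_diff[of 0 0] by simp

text \<open>The constant function \<open>1\<close> lies in \<open>L\<^sup>2\<close>, and \<open>M\<^sub>g 1 = g\<close>.\<close>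

lemma mult_op_eq_0_iff: "mult_op f = 0 \<longleftrightarrow> f = 0"
proof
  assume "mult_op f = 0"
  then have *: "mult_L2 f x = 0" for x
    by (simp add: zero_bop.rep_eq flip: mult_op.rep_eq)
  obtain u where u: "Linf_fun u" "f = abs_Linf u" by (rule Linf_rep)
  have "abs_L2 u = 0"
    using *[of "abs_L2 (\<lambda>z. 1)"] u by (simp add: mult_L2_abs L2_fun_one)
  moreover have "L2_fun u"
    using Linf_L2_mult[OF u(1) L2_fun_one] by simp
  ultimately have "AE z in circle. u z = 0"
    using Quotient3_rel[OF Quotient3_L2, of u "\<lambda>z. 0"] by (auto simp: zero_L2_def L2_fun_zero)
  then show "f = 0"
    using u by (simp add: zero_Linf_def abs_Linf_eq_iff Linf_fun_const)
qed (simp add: mult_op_0)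

lemma cinner_abs_L2:
  "L2_fun f \<Longrightarrow> L2_fun g \<Longrightarrow> cinner (abs_L2 f) (abs_L2 g) = (LINT z|circle. f z * cnj (g z))"
  by (simp add: cinner_L2_def cinner_L2_raw.abs_eq)

lemma cinner_mult_L2: "cinner (mult_L2 f x) y = cinner x (mult_L2 (Linf_cnj f) y)"
  unfolding cinner_L2_def by transfer (simp add: mult_ac)

lemma bop_adj_mult_op: "bop_adj (mult_op f) = mult_op (Linf_cnj f)"
  by (rule bop_adj_eqI) (simp add: mult_op.rep_eq cinner_mult_L2)

text \<open>The quadratic form of \<open>M\<^sub>r\<close> at \<open>f\<close> is the integral of \<open>r \<bar>f\<bar>\<^sup>2\<close>; testing it on the indicator
  function of the set \<open>{r < 0}\<close> detects the sign of \<open>r\<close>.\<close>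

lemma positive_mult_op_iff:
  fixes r :: "complex \<Rightarrow> real"
  assumes r: "Linf_fun (\<lambda>z. complex_of_real (r z))"
  shows "positive_op (mult_op (abs_Linf (\<lambda>z. complex_of_real (r z)))) \<longleftrightarrow> (AE z in circle. 0 \<le> r z)"
    (is "positive_op ?M \<longleftrightarrow> _")
proof -
  have form: "cinner (bop_apply ?M (abs_L2 f)) (abs_L2 f)
      = complex_of_real (LINT z|circle. r z * (cmod (f z))\<^sup>2)" if "L2_fun f" for f
  proof -
    have "cinner (bop_apply ?M (abs_L2 f)) (abs_L2 f)
        = (LINT z|circle. complex_of_real (r z) * f z * cnj (f z))"
      using that r by (simp add: mult_op.rep_eq mult_L2_abs cinner_abs_L2 Linf_L2_mult)
    also have "(\<lambda>z. complex_of_real (r z) * f z * cnj (f z))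
        = (\<lambda>z. complex_of_real (r z * (cmod (f z))\<^sup>2))"
      by (simp add: fun_eq_iff complex_norm_square mult.assoc del: of_real_power)
    finally show ?thesis
      by (simp only: integral_complex_of_real)
  qed
  have [measurable]: "r \<in> borel_measurable circle"
  proof -
    have "(\<lambda>z. Re (complex_of_real (r z))) \<in> borel_measurable circle"
      by (rule measurable_compose[OF r[unfolded Linf_fun_def, THEN conjunct1] borel_measurable_Re])
    then show ?thesis by simp
  qed
  show ?thesis
  proof
    assume pos: "positive_op ?M"
    let ?h = "indicator {z \<in> space circle. r z < 0} :: complex \<Rightarrow> complex"
    let ?k = "\<lambda>z. - (r z * indicator {z \<in> space circle. r z < 0} z)"
    have hk: "- (r z * (cmod (?h z))\<^sup>2) = ?k z" for z
      by (simp add: indicator_def)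
    have h: "L2_fun ?h"
      unfolding L2_fun_def
      by (auto intro!: circle.integrable_const_bound[where B = 1] simp: indicator_def)
    have int: "integrable circle ?k"
    proof -
      obtain C where C: "AE z in circle. cmod (complex_of_real (r z)) \<le> C"
        using r by (auto simp: Linf_fun_def)
      show ?thesis
      proof (rule circle.integrable_const_bound[where B = C])
        show "AE z in circle. norm (?k z) \<le> C"
          using C by eventually_elim (auto simp: indicator_def)
      qed measurable
    qed
    have k0: "0 \<le> ?k z" for z by (simp add: indicator_def)
    have "0 \<le> (LINT z|circle. r z * (cmod (?h z))\<^sup>2)"
      using positive_op_Re[OF pos, of "abs_L2 ?h"] by (simp only: form[OF h] Re_complex_of_real)
    moreover have "(LINT z|circle. ?k z) = - (LINT z|circle. r z * (cmod (?h z))\<^sup>2)"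
      by (simp only: hk[symmetric] integral_minus)
    ultimately have "(LINT z|circle. ?k z) \<le> 0"
      by linarith
    moreover have "0 \<le> (LINT z|circle. ?k z)"
      by (intro integral_nonneg_AE AE_I2 k0)
    ultimately have "(LINT z|circle. ?k z) = 0" by linarith
    then have "AE z in circle. ?k z = 0"
      using integral_nonneg_eq_0_iff_AE[OF int] k0 by simp
    then show "AE z in circle. 0 \<le> r z"
      using AE_space by eventually_elim (auto simp: indicator_def split: if_splits)
  next
    assume nn: "AE z in circle. 0 \<le> r z"
    show "positive_op ?M"
      unfolding positive_op_def
    proof
      fix x :: L2
      obtain f where f: "L2_fun f" "x = abs_L2 f" by (rule L2_rep)
      have "0 \<le> (LINT z|circle. r z * (cmod (f z))\<^sup>2)"
        using nn by (intro integral_nonneg_AE) (auto elim: eventually_mono)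
      then show "cinner (bop_apply ?M x) x \<in> \<real>\<^sub>\<ge>\<^sub>0"
        by (simp add: f form)
    qed
  qed
qed

lemma positive_mult_op_abs: "positive_op (mult_op (Linf_abs f))"
proof -
  obtain u where u: "Linf_fun u" "f = abs_Linf u" by (rule Linf_rep)
  then show ?thesis
    by (simp add: Linf_abs.abs_eq positive_mult_op_iff Linf_fun_cmod)
qed

lemma Linf_abs_mult_self: "Linf_abs f * Linf_abs f = f * Linf_cnj f"
proof -
  have "complex_of_real (cmod w) * complex_of_real (cmod w) = w * cnj w" for w
    by (metis complex_norm_square of_real_mult power2_eq_square)
  then show ?thesis
    by transfer (simp add: Linf_fun_mult Linf_fun_cnj)
qed

lemma op_sqrt_mult_op: "op_sqrt (mult_op (f * Linf_cnj f)) = mult_op (Linf_abs f)"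
  by (rule op_sqrt_eqI) (simp_all add: positive_mult_op_abs Linf_abs_mult_self flip: mult_op_mult)

text \<open>Through this equivalence the Cauchy property and convergence for the operator-valued norm become
  the almost everywhere uniform ones.\<close>

lemma mult_op_abs_le_iff:
  assumes u: "Linf_fun u"
  shows "mult_op (Linf_abs (abs_Linf u)) \<sqsubseteq> complex_of_real e *\<^sub>C bop_id \<longleftrightarrow>
    (AE z in circle. cmod (u z) \<le> e)"
proof -
  have *: "complex_of_real e *\<^sub>C bop_id - mult_op (Linf_abs (abs_Linf u))
      = mult_op (abs_Linf (\<lambda>z. complex_of_real (e - cmod (u z))))"
    using u by (simp add: Linf_abs.abs_eq scaleC_Linf.abs_eq minus_Linf.abs_eq Linf_fun_const
        Linf_fun_cmod flip: mult_op_one mult_op_scaleC mult_op_diff)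
  have "Linf_fun (\<lambda>z. complex_of_real (e - cmod (u z)))"
    using Linf_fun_diff[OF Linf_fun_const Linf_fun_cmod[OF u], of "complex_of_real e"] by simp
  from positive_mult_op_iff[OF this] show ?thesis
    by (simp add: op_le_def *)
qed

section \<open>The induced norm\<close>

lemma mult_op_abs_triangle:
  "mult_op (Linf_abs (f + g)) \<sqsubseteq> mult_op (Linf_abs f) + mult_op (Linf_abs g)"
proof -
  obtain u where u: "Linf_fun u" "f = abs_Linf u" by (rule Linf_rep)
  obtain v where v: "Linf_fun v" "g = abs_Linf v" by (rule Linf_rep)
  have "Linf_fun (\<lambda>z. complex_of_real (cmod (u z) + cmod (v z) - cmod (u z + v z)))"
    using Linf_fun_diff[OF Linf_fun_add[OF Linf_fun_cmod[OF u(1)] Linf_fun_cmod[OF v(1)]]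
        Linf_fun_cmod[OF Linf_fun_add[OF u(1) v(1)]]] by simp
  moreover have "mult_op (Linf_abs f) + mult_op (Linf_abs g) - mult_op (Linf_abs (f + g))
      = mult_op (abs_Linf (\<lambda>z. complex_of_real (cmod (u z) + cmod (v z) - cmod (u z + v z))))"
    using u v by (simp add: Linf_abs.abs_eq plus_Linf.abs_eq minus_Linf.abs_eq Linf_fun_add
        Linf_fun_cmod flip: mult_op_add mult_op_diff)
  ultimately show ?thesis
    by (simp add: op_le_def positive_mult_op_iff norm_triangle_ineq del: of_real_add of_real_diff)
qed

lemma Linf_abs_scaleC: "Linf_abs (c *\<^sub>C f) = complex_of_real (cmod c) *\<^sub>C Linf_abs f"
  by transfer (simp add: norm_mult Linf_fun_cmod Linf_fun_scale)

lemma Linf_abs_eq_0_iff: "Linf_abs f = 0 \<longleftrightarrow> f = 0"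
  by transfer (simp add: Linf_fun_cmod Linf_fun_const)

lemma op_valued_norm_mult_op_abs: "op_valued_norm (\<lambda>f. mult_op (Linf_abs f))"
  unfolding op_valued_norm_def
  by (simp add: mult_op_abs_triangle Linf_abs_scaleC mult_op_scaleC mult_op_eq_0_iff
      Linf_abs_eq_0_iff op_le_def[of 0] positive_mult_op_abs)

text \<open>The functions \<open>f x\<close> and \<open>\<bar>f\<bar> x\<close> have the same modulus at every point, so \<open>M\<^sub>f x\<close> and
  \<open>M\<^bsub>\<bar>f\<bar>\<^esub> x\<close> have the same norm in \<open>L\<^sup>2\<close>.\<close>

lemma bop_norm_mult_op_abs: "bop_norm (mult_op (Linf_abs f)) = bop_norm (mult_op f)"
proof -
  have "norm (mult_L2 (Linf_abs f) x) = norm (mult_L2 f x)" for x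
  proof -
    obtain u where u: "Linf_fun u" "f = abs_Linf u" by (rule Linf_rep)
    obtain h where h: "L2_fun h" "x = abs_L2 h" by (rule L2_rep)
    have "(norm (mult_L2 (Linf_abs f) x))\<^sup>2 = (norm (mult_L2 f x))\<^sup>2"
      using u h by (simp add: Linf_abs.abs_eq mult_L2_abs Linf_fun_cmod norm_abs_L2 Linf_L2_mult
          norm_mult)
    then show ?thesis by simp
  qed
  then show ?thesis
    by (simp add: bop_norm.rep_eq mult_op.rep_eq onorm_def)
qed

lemma Linf_abs_cnj: "Linf_abs (Linf_cnj f) = Linf_abs f"
  by transfer (simp add: Linf_fun_cmod)

lemma bop_norm_comp_le: "bop_norm (bop_comp S T) \<le> bop_norm S * bop_norm T"
  using onorm_compose[OF bounded_linear_bop_apply[of S] bounded_linear_bop_apply[of T]]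
  by (simp add: bop_norm.rep_eq bop_comp.rep_eq o_def)

text \<open>
  This is completeness of \<open>L\<^sup>\<infinity>\<close>.  Only the countably many tolerances \<open>1 / (k + 1)\<close> and pairs of
  indices matter for the Cauchy property, so the exceptional null sets can be united into one; off it
  the sequence is uniformly Cauchy, and its pointwise limit is within \<open>1\<close> of some term, hence
  essentially bounded.
\<close>

lemma op_complete_mult_op_abs: "op_complete (\<lambda>f. mult_op (Linf_abs f))"
  unfolding op_complete_def
proof (intro allI impI)
  fix X :: "nat \<Rightarrow> Linf"
  assume X: "op_Cauchy (\<lambda>f. mult_op (Linf_abs f)) X"
  have "\<forall>n. \<exists>u. Linf_fun u \<and> X n = abs_Linf u"
    by (metis Linf_rep)
  then obtain U where U: "\<And>n. Linf_fun (U n)" and XU: "\<And>n. X n = abs_Linf (U n)"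
    by metis
  have [measurable]: "U n \<in> borel_measurable circle" for n
    using U[of n] by (simp add: Linf_fun_def)
  have ex: "\<exists>N. \<forall>n\<ge>N. \<forall>m\<ge>N. AE z in circle. cmod (U n z - U m z) \<le> e" if "e > 0" for e
    using X that U
    by (simp add: op_Cauchy_def XU minus_Linf.abs_eq mult_op_abs_le_iff Linf_fun_diff)
  then have "\<forall>k. \<exists>N. \<forall>n\<ge>N. \<forall>m\<ge>N. AE z in circle. cmod (U n z - U m z) \<le> 1 / Suc k"
    by simp
  then obtain N where N: "\<And>k n m. n \<ge> N k \<Longrightarrow> m \<ge> N k \<Longrightarrow>
      AE z in circle. cmod (U n z - U m z) \<le> 1 / Suc k"
    by metis
  have unif: "AE z in circle. \<forall>k n m. n \<ge> N k \<longrightarrow> m \<ge> N k \<longrightarrow> cmod (U n z - U m z) \<le> 1 / Suc k"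
    unfolding AE_all_countable using N by (auto intro: AE_I2)
  define f where "f z = lim (\<lambda>n. U n z)" for z
  have [measurable]: "f \<in> borel_measurable circle"
    unfolding f_def by measurable
  have conv: "AE z in circle. (\<lambda>n. U n z) \<longlonglongrightarrow> f z"
    using unif
  proof eventually_elim
    case (elim z)
    have "Cauchy (\<lambda>n. U n z)"
    proof (rule metric_CauchyI)
      fix e :: real assume "e > 0"
      then obtain k where k: "1 / Suc k < e" by (metis nat_approx_posE)
      show "\<exists>M. \<forall>m\<ge>M. \<forall>n\<ge>M. dist (U m z) (U n z) < e"
        using elim k by (intro exI[of _ "N k"]) (force simp: dist_norm)
    qed
    then show ?case
      by (simp add: f_def Cauchy_convergent_iff convergent_LIMSEQ_iff)
  qed
  \<comment> \<open>Fixing \<open>n\<close> and letting \<open>m\<close> tend to infinity keeps the non-strict Cauchy estimate.\<close>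
  have lim: "AE z in circle. cmod (U n z - f z) \<le> e"
    if *: "\<And>m. m \<ge> M \<Longrightarrow> AE z in circle. cmod (U n z - U m z) \<le> e" for n M e
  proof -
    have "AE z in circle. \<forall>m. m \<ge> M \<longrightarrow> cmod (U n z - U m z) \<le> e"
      unfolding AE_all_countable using * by (auto intro: AE_I2)
    then show ?thesis
      using conv
    proof eventually_elim
      case (elim z)
      have "(\<lambda>m. cmod (U n z - U m z)) \<longlonglongrightarrow> cmod (U n z - f z)"
        by (intro tendsto_intros elim)
      then show ?case
        by (rule LIMSEQ_le_const2) (use elim in blast)
    qed
  qed
  have f: "Linf_fun f"
  proof -
    obtain C where C: "AE z in circle. cmod (U (N 0) z) \<le> C"
      using U[of "N 0"] by (auto simp: Linf_fun_def)
    have "AE z in circle. cmod (U (N 0) z - f z) \<le> 1"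
      by (rule lim) (use N[of 0 "N 0"] in simp)
    then have "AE z in circle. cmod (f z) \<le> C + 1"
      using C
    proof eventually_elim
      case (elim z)
      then show ?case
        using norm_triangle_ineq4[of "U (N 0) z" "U (N 0) z - f z"] by simp
    qed
    then show ?thesis by (auto simp: Linf_fun_def)
  qed
  show "\<exists>x. op_converges (\<lambda>f. mult_op (Linf_abs f)) X x"
  proof (rule exI[of _ "abs_Linf f"], unfold op_converges_def, intro allI impI)
    fix e :: real assume "e > 0"
    then obtain M where "\<forall>n\<ge>M. \<forall>m\<ge>M. AE z in circle. cmod (U n z - U m z) \<le> e"
      using ex by blast
    then have "\<forall>n\<ge>M. AE z in circle. cmod (U n z - f z) \<le> e"
      by (blast intro: lim)
    then show "\<exists>M. \<forall>n\<ge>M. mult_op (Linf_abs (X n - abs_Linf f)) \<sqsubseteq> complex_of_real e *\<^sub>C bop_id"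
      using U f by (auto simp: XU minus_Linf.abs_eq mult_op_abs_le_iff Linf_fun_diff)
  qed
qed

section \<open>The inner product\<close>

lemma op_inner_product_mult_op: "op_inner_product (\<lambda>f g. mult_op (f * Linf_cnj g))"
  unfolding op_inner_product_def conjugate_bilinear_def
proof (intro conjI disjI1 allI)
  fix f f' g g' :: Linf and c :: complex
  have "(f + f') * Linf_cnj g = f * Linf_cnj g + f' * Linf_cnj g"
    by transfer (simp add: Linf_fun_add Linf_fun_mult Linf_fun_cnj distrib_right)
  then show "mult_op ((f + f') * Linf_cnj g) = mult_op (f * Linf_cnj g) + mult_op (f' * Linf_cnj g)"
    by (simp add: mult_op_add)
  have "f * Linf_cnj (g + g') = f * Linf_cnj g + f * Linf_cnj g'"
    by transfer (simp add: Linf_fun_add Linf_fun_mult Linf_fun_cnj distrib_left)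
  then show "mult_op (f * Linf_cnj (g + g')) = mult_op (f * Linf_cnj g) + mult_op (f * Linf_cnj g')"
    by (simp add: mult_op_add)
  have "(c *\<^sub>C f) * Linf_cnj g = c *\<^sub>C (f * Linf_cnj g)"
    by transfer (simp add: Linf_fun_scale Linf_fun_mult Linf_fun_cnj mult.assoc)
  then show "mult_op (c *\<^sub>C f * Linf_cnj g) = c *\<^sub>C mult_op (f * Linf_cnj g)"
    by (simp add: mult_op_scaleC)
  have "f * Linf_cnj (c *\<^sub>C g) = cnj c *\<^sub>C (f * Linf_cnj g)"
    by transfer (simp add: Linf_fun_scale Linf_fun_mult Linf_fun_cnj mult.left_commute)
  then show "mult_op (f * Linf_cnj (c *\<^sub>C g)) = cnj c *\<^sub>C mult_op (f * Linf_cnj g)"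
    by (simp add: mult_op_scaleC)
  obtain u where u: "Linf_fun u" "f = abs_Linf u" by (rule Linf_rep)
  have ff: "f * Linf_cnj f = abs_Linf (\<lambda>z. complex_of_real ((cmod (u z))\<^sup>2))"
    using u by (simp add: times_Linf.abs_eq Linf_cnj.abs_eq Linf_fun_cnj complex_norm_square
        del: of_real_power)
  have sq: "Linf_fun (\<lambda>z. complex_of_real ((cmod (u z))\<^sup>2))"
    using Linf_fun_mult[OF u(1) Linf_fun_cnj[OF u(1)]]
    by (simp add: complex_norm_square del: of_real_power)
  show "0 \<sqsubseteq> mult_op (f * Linf_cnj f)"
    by (simp add: op_le_def ff positive_mult_op_iff[OF sq] del: of_real_power)
  show "mult_op (f * Linf_cnj f) = 0 \<longleftrightarrow> f = 0"
    unfolding mult_op_eq_0_iff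
    by transfer (simp add: Linf_fun_mult Linf_fun_cnj Linf_fun_const)
  have "f * Linf_cnj g = Linf_cnj (g * Linf_cnj f)"
    by transfer (simp add: Linf_fun_mult Linf_fun_cnj mult.commute)
  then show "mult_op (f * Linf_cnj g) = bop_adj (mult_op (g * Linf_cnj f))"
    by (simp add: bop_adj_mult_op)
qed

theorem theorem3p8:
  fixes \<phi> :: "Linf \<Rightarrow> Linf \<Rightarrow> L2 bop"
  assumes "\<And>f g. \<phi> f g = mult_op (f * Linf_cnj g)"
  shows "bounded_op_inner_product \<phi> \<and> Hilbert_space_wrt \<phi>"
proof -
  have \<phi>: "\<phi> = (\<lambda>f g. mult_op (f * Linf_cnj g))"
    using assms by (simp add: fun_eq_iff)
  have F: "induced_norm \<phi> = (\<lambda>f. mult_op (Linf_abs f))"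
    by (simp add: fun_eq_iff induced_norm_def \<phi> op_sqrt_mult_op)
  have "bop_norm (\<phi> f g) \<le> 1 * bop_norm (induced_norm \<phi> f) * bop_norm (induced_norm \<phi> g)" for f g
    using bop_norm_comp_le[of "mult_op f" "mult_op (Linf_cnj g)"]
      bop_norm_mult_op_abs[of "Linf_cnj g"]
    by (simp add: F bop_norm_mult_op_abs Linf_abs_cnj, simp add: \<phi> mult_op_mult)
  then have "\<exists>M>0. \<forall>f g. bop_norm (\<phi> f g)
      \<le> M * bop_norm (induced_norm \<phi> f) * bop_norm (induced_norm \<phi> g)"
    using zero_less_one by blast
  then show ?thesis
    using op_inner_product_mult_op op_valued_norm_mult_op_abs op_complete_mult_op_abs
    by (simp add: bounded_op_inner_product_def Hilbert_space_wrt_def F flip: \<phi>)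
qed

end
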